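(* Let $\Omega,\Lambda\subset\mathbb{R}^n$ be bounded open sets with $\Lambda$ convex, and let $f\in C^{0,\alpha}(\overline{\Omega})$ and $g\in C^{0,\alpha}(\overline{\Lambda})$ be positive functions, each bounded away from zero and infinity, with $\int_\Omega f\,dx=\int_\Lambda g\,dx$. Let $\varphi$ be the Brenier potential: the convex function, unique up to an additive constant, such that $\nabla\varphi$ is the optimal transport map for the quadratic cost from $\mu=f\,dx$ to $\nu=g\,dx$; it lies in $C^{2,\alpha}(\Omega)$ and solves $$\det(\nabla^2\varphi(x))=\frac{f(x)}{g(\nabla\varphi(x))},\quad x\in\Omega,\qquad \partial\varphi(\Omega)\subset\overline{\Lambda}.$$ Then, for each $i\in\{1,2\}$, $\varphi$ is the unique (up to an additive constant) solution of the optimization problem $$\underset{\psi\in\mathcal{J}}{\mathrm{minimize}}\ \ \mathcal{F}(\psi):=\int_\Omega \mathcal{G}_i(\psi,x)\,dx,$$ where $$\mathcal{J}:=\{\psi\in C^2(\Omega)\,:\,\psi\ \text{convex and}\ \nabla\psi(\Omega)\subseteq\Lambda\},$$ $$\mathcal{G}_1(\psi,x):=\max\left\{0,\,-\log\det(\nabla^2\psi(x))-\log g(\nabla\psi(x))+\log f(x)\right\},$$ $$\mathcal{G}_2(\psi,x):=\max\left\{0,\,-\big(\det(\nabla^2\psi(x))\big)^{1/n}+\big(f(x)/g(\nabla\psi(x))\big)^{1/n}\right\}.$$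
   Context: $\partial\varphi$ denotes the subdifferential map of the convex function $\varphi$. The set $\Omega$ is not assumed convex or connected; a function on $\Omega$ is called convex if it is the restriction to $\Omega$ of a finite convex function on $\mathbb{R}^n$. Convention: $-\log 0=+\infty$, so $\mathcal{G}_1$ and $\mathcal{F}$ take values in $[0,+\infty]$. $C^{2,\alpha}(\Omega)$ is meant in the interior (local) sense. *)

theory Defs
  imports "HOL-Analysis.Analysis"
begin

text \<open>Functions on a set \<open>S\<close> of \<open>\<real>\<^sup>n\<close> are total functions on \<^typ>\<open>real ^ 'n\<close> whose values
  outside \<open>S\<close> are irrelevant.\<close>

definition holder_on :: "real \<Rightarrow> 'a::metric_space set \<Rightarrow> ('a \<Rightarrow> 'b::metric_space) \<Rightarrow> bool" where
  "holder_on \<alpha> S f \<longleftrightarrow> (\<exists>C. \<forall>x\<in>S. \<forall>y\<in>S. dist (f x) (f y) \<le> C * dist x y powr \<alpha>)"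

definition gradient :: "('a::real_inner \<Rightarrow> real) \<Rightarrow> 'a \<Rightarrow> 'a" where
  "gradient \<phi> x = (THE D. GDERIV \<phi> x :> D)"

definition hessian :: "(real ^ 'n \<Rightarrow> real) \<Rightarrow> real ^ 'n \<Rightarrow> real ^ 'n ^ 'n" where
  "hessian \<phi> x = jacobian (gradient \<phi>) (at x)"

text \<open>For open \<open>S\<close>; no boundary regularity is required.\<close>

definition C2_on :: "(real ^ 'n) set \<Rightarrow> (real ^ 'n \<Rightarrow> real) \<Rightarrow> bool" where
  "C2_on S \<phi> \<longleftrightarrow>
     (\<forall>x\<in>S. \<phi> differentiable (at x)) \<and>
     (\<forall>x\<in>S. gradient \<phi> differentiable (at x)) \<and>
     continuous_on S (hessian \<phi>)"

definition C2_holder_on :: "real \<Rightarrow> (real ^ 'n) set \<Rightarrow> (real ^ 'n \<Rightarrow> real) \<Rightarrow> bool" where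
  "C2_holder_on \<alpha> S \<phi> \<longleftrightarrow>
     C2_on S \<phi> \<and> (\<forall>K. compact K \<and> K \<subseteq> S \<longrightarrow> holder_on \<alpha> K (hessian \<phi>))"

definition subdifferential :: "('a::real_inner \<Rightarrow> real) \<Rightarrow> 'a \<Rightarrow> 'a set" where
  "subdifferential \<phi> x = {p. \<forall>y. \<phi> y \<ge> \<phi> x + p \<bullet> (y - x)}"

definition convex_restriction :: "'a::real_vector set \<Rightarrow> ('a \<Rightarrow> real) \<Rightarrow> bool" where
  "convex_restriction S \<psi> \<longleftrightarrow> (\<exists>\<Phi>. convex_on UNIV \<Phi> \<and> (\<forall>x\<in>S. \<Phi> x = \<psi> x))"

definition mass_on :: "'a::euclidean_space set \<Rightarrow> ('a \<Rightarrow> real) \<Rightarrow> 'a measure" where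
  "mass_on S f = density lborel (\<lambda>x. ennreal (f x) * indicator S x)"

definition transport_map :: "'a measure \<Rightarrow> 'b measure \<Rightarrow> ('a \<Rightarrow> 'b) \<Rightarrow> bool" where
  "transport_map M N T \<longleftrightarrow> T \<in> measurable M N \<and> distr M N T = N"

definition quadratic_cost :: "'a::metric_space measure \<Rightarrow> ('a \<Rightarrow> 'a) \<Rightarrow> ennreal" where
  "quadratic_cost M T = (\<integral>\<^sup>+ x. ennreal ((dist x (T x))\<^sup>2) \<partial>M)"

definition optimal_transport_map ::
    "'a::metric_space measure \<Rightarrow> 'a measure \<Rightarrow> ('a \<Rightarrow> 'a) \<Rightarrow> bool" where
  "optimal_transport_map M N T \<longleftrightarrow> is_arg_min (quadratic_cost M) (transport_map M N) T"

text \<open>The source measure is restricted to the space \<open>\<Omega>\<close>, because \<open>\<nabla>\<phi>\<close> need not exist (and so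
  \<^const>\<open>gradient\<close> is unspecified) at some points outside \<open>\<Omega>\<close>. The target measure lives on the
  whole of \<open>\<real>\<^sup>n\<close>, so transport maps are not required to take values in \<open>\<Lambda>\<close> everywhere.\<close>

definition brenier_potential ::
    "'a::euclidean_space set \<Rightarrow> ('a \<Rightarrow> real) \<Rightarrow> 'a set \<Rightarrow> ('a \<Rightarrow> real) \<Rightarrow> ('a \<Rightarrow> real) \<Rightarrow> bool" where
  "brenier_potential \<Omega> f \<Lambda> g \<phi> \<longleftrightarrow>
     convex_on UNIV \<phi> \<and>
     optimal_transport_map (restrict_space (mass_on \<Omega> f) \<Omega>) (mass_on \<Lambda> g) (gradient \<phi>)"

definition admissible ::
    "(real ^ 'n) set \<Rightarrow> (real ^ 'n) set \<Rightarrow> (real ^ 'n \<Rightarrow> real) set" where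
  "admissible \<Omega> \<Lambda> = {\<psi>. C2_on \<Omega> \<psi> \<and> convex_restriction \<Omega> \<psi> \<and> gradient \<psi> ` \<Omega> \<subseteq> \<Lambda>}"

text \<open>Logarithm on \<open>[0, \<infinity>)\<close> with \<open>log 0 = -\<infinity>\<close>; negative arguments do not occur below,
  since Hessians of convex functions have nonnegative determinant.\<close>

definition elog :: "real \<Rightarrow> ereal" where
  "elog t = (if t > 0 then ereal (ln t) else - \<infinity>)"

definition G1 :: "(real ^ 'n \<Rightarrow> real) \<Rightarrow> (real ^ 'n \<Rightarrow> real) \<Rightarrow>
    (real ^ 'n \<Rightarrow> real) \<Rightarrow> real ^ 'n \<Rightarrow> ennreal" where
  "G1 f g \<psi> x = e2ennreal (max 0
     (- elog (det (hessian \<psi> x)) - ereal (ln (g (gradient \<psi> x))) + ereal (ln (f x))))"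

definition G2 :: "(real ^ 'n \<Rightarrow> real) \<Rightarrow> (real ^ 'n \<Rightarrow> real) \<Rightarrow>
    (real ^ 'n \<Rightarrow> real) \<Rightarrow> real ^ 'n \<Rightarrow> ennreal" where
  "G2 f g \<psi> x = ennreal (max 0
     (- root CARD('n) (det (hessian \<psi> x)) + root CARD('n) (f x / g (gradient \<psi> x))))"

definition objective :: "'a::euclidean_space set \<Rightarrow> (('a \<Rightarrow> real) \<Rightarrow> 'a \<Rightarrow> ennreal) \<Rightarrow>
    ('a \<Rightarrow> real) \<Rightarrow> ennreal" where
  "objective \<Omega> G \<psi> = (\<integral>\<^sup>+ x \<in> \<Omega>. G \<psi> x \<partial>lborel)"

end

theory Submission
  imports Defs
begin

text \<open>The minimum is \<open>0\<close>, attained at \<open>\<phi>\<close>. If the objective vanishes at \<open>\<psi>\<close>, then by continuity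
  \<open>det \<nabla>\<^sup>2\<psi> \<ge> f / g(\<nabla>\<psi>)\<close> on all of \<open>\<Omega>\<close>; since \<open>\<nabla>\<psi>\<close> is injective with values in \<open>\<Lambda>\<close>, the change of
  variables formula and the mass balance force equality, so \<open>\<nabla>\<psi>\<close> transports \<open>f\<close> to \<open>g\<close> and has dense
  image in \<open>\<Lambda>\<close>. Integrating the duality gaps of \<open>\<phi>\<close> and \<open>\<psi>\<close> along each other's gradients gives
  \<open>\<nabla>\<psi> = \<nabla>\<phi>\<close>. As \<open>\<Omega>\<close> may be disconnected, the additive constant is found on the target side: the
  Legendre transforms share a subgradient at every point of the convex set \<open>\<Lambda>\<close>, hence differ by a
  constant there, and so do \<open>\<phi>\<close> and \<open>\<psi>\<close> on \<open>\<Omega>\<close>.\<close>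

subsection \<open>Change of variables over an arbitrary finite index type\<close>

text \<open>The change of variables theorem of the library requires a wellordered index type, so it is
  transported from a wellordered copy of the index type.\<close>

typedef 'a wo_copy = "UNIV :: 'a set" by blast

instance wo_copy :: (finite) finite
proof
  have "finite (Abs_wo_copy ` (UNIV :: 'a set))"
    by simp
  then show "finite (UNIV :: 'a wo_copy set)"
    by (metis (full_types) Abs_wo_copy_cases UNIV_eq_I finite_subset image_eqI subsetI)
qed

text \<open>Any injection into the naturals will do: the order on \<open>wo_copy\<close> is pulled
  back along it, and induction on \<open>nat\<close> makes it a wellorder.\<close>

definition wo_index :: "'a::finite wo_copy \<Rightarrow> nat" where
  "wo_index = (SOME h. inj h)"

lemma inj_wo_index: "inj wo_index"
proof -
  have "\<exists>h :: 'a::finite wo_copy \<Rightarrow> nat. inj h"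
    using finite_imp_inj_to_nat_seg[of "UNIV :: 'a wo_copy set"] by auto
  then show ?thesis
    unfolding wo_index_def by (rule someI_ex)
qed

instantiation wo_copy :: (finite) wellorder
begin

definition "x \<le> y \<longleftrightarrow> wo_index x \<le> wo_index y"
definition "x < y \<longleftrightarrow> wo_index x < wo_index y"

instance
proof
  fix P :: "'a wo_copy \<Rightarrow> bool" and a :: "'a wo_copy"
  assume step: "\<And>x. (\<And>y. y < x \<Longrightarrow> P y) \<Longrightarrow> P x"
  show "P a"
    by (induction "wo_index a" arbitrary: a rule: less_induct) (metis step less_wo_copy_def)
qed (use inj_wo_index in \<open>auto simp: less_eq_wo_copy_def less_wo_copy_def inj_def\<close>)

end

section \<open>Relabelling of coordinates along a bijection of index types\<close>

definition reindex :: "('m \<Rightarrow> 'n) \<Rightarrow> real ^ 'n \<Rightarrow> real ^ 'm" where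
  "reindex c x = (\<chi> i. x $ c i)"

lemma reindex_component [simp]: "reindex c x $ i = x $ c i"
  by (simp add: reindex_def)

lemma reindex_reindex [simp]:
  assumes "bij c"
  shows "reindex (inv c) (reindex c x) = x" "reindex c (reindex (inv c) y) = y"
  using assms by (simp_all add: vec_eq_iff bij_is_surj surj_f_inv_f bij_is_inj)

lemma linear_reindex: "linear (reindex c)"
  by (rule linearI) (simp_all add: vec_eq_iff)

lemma norm_reindex:
  fixes c :: "'m::finite \<Rightarrow> 'n::finite"
  assumes "bij c"
  shows "norm (reindex c x) = norm x"
proof -
  have "(\<Sum>i\<in>UNIV. (x $ c i)\<^sup>2) = (\<Sum>i\<in>UNIV. (x $ i)\<^sup>2)"
    using sum.reindex_bij_betw[OF assms, of "\<lambda>i. (x $ i)\<^sup>2"] by simp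
  then show ?thesis
    by (simp add: norm_vec_def L2_set_def)
qed

lemma reindex_image_eq_vimage:
  assumes "bij c"
  shows "reindex c ` S = reindex (inv c) -` S"
  using assms by (force intro: image_eqI)

lemma reindex_image_cbox:
  fixes c :: "'m::finite \<Rightarrow> 'n::finite"
  assumes "bij c"
  shows "reindex c ` cbox a b = cbox (reindex c a) (reindex c b)"
proof -
  have "reindex (inv c) x \<in> cbox a b \<longleftrightarrow> x \<in> cbox (reindex c a) (reindex c b)" for x
    using assms by (auto simp: mem_box_cart) (metis bij_inv_eq_iff)+
  then show ?thesis
    by (auto simp: reindex_image_eq_vimage[OF assms])
qed

lemma content_reindex_image_cbox:
  fixes c :: "'m::finite \<Rightarrow> 'n::finite"
  assumes "bij c"
  shows "measure lborel (reindex c ` cbox a b) = measure lborel (cbox a b)"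
proof (cases "cbox a b = {}")
  case False
  then have "cbox (reindex c a) (reindex c b) \<noteq> {}"
    by (metis assms image_is_empty reindex_image_cbox)
  moreover have "(\<Prod>i\<in>UNIV. b $ c i - a $ c i) = (\<Prod>i\<in>UNIV. b $ i - a $ i)"
    using prod.reindex_bij_betw[OF assms, of "\<lambda>i. b $ i - a $ i"] by simp
  ultimately show ?thesis
    using False by (simp add: reindex_image_cbox[OF assms] content_cbox_cart)
qed simp

text \<open>Relabelling is a linear isometry taking boxes to boxes of the same content, so on each
  box the integral transforms with factor 1. Balls about the origin are preserved, so the limit over
  growing boxes transfers as well.\<close>

lemma has_integral_reindex:
  fixes c :: "'m::finite \<Rightarrow> 'n::finite" and f :: "real ^ 'm \<Rightarrow> real"
  assumes c: "bij c" and f: "(f has_integral i) S"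
  shows "((\<lambda>x. f (reindex c x)) has_integral i) (reindex c -` S)"
proof -
  \<comment> \<open>Extension by zero expresses the integral over \<open>S\<close> through integrals
    over boxes, where the substitution rule applies.\<close>
  define F where "F = (\<lambda>x. if x \<in> S then f x else 0)"
  have ic: "bij (inv c)" "inv (inv c) = c"
    using c by (simp_all add: bij_imp_bij_inv inv_inv_eq)
  have F: "\<And>a b. F integrable_on cbox a b"
    "\<And>e. e > 0 \<Longrightarrow> \<exists>B>0. \<forall>a b. ball 0 B \<subseteq> cbox a b \<longrightarrow> norm (integral (cbox a b) F - i) < e"
    using f unfolding has_integral_alt'[of f] F_def by blast+
  have tw: "((\<lambda>x. F (reindex c x)) has_integral integral (cbox (reindex c a) (reindex c b)) F) (cbox a b)"
    for a b
  proof -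
    have "((\<lambda>x. F (reindex c x)) has_integral (1/1) *\<^sub>R integral (cbox (reindex c a) (reindex c b)) F)
       (reindex (inv c) ` cbox (reindex c a) (reindex c b))"
    proof (rule has_integral_twiddle)
      show "isCont (reindex c) x" for x
        by (simp add: linear_continuous_at linear_linear linear_reindex)
      show "(F has_integral integral (cbox (reindex c a) (reindex c b)) F) (cbox (reindex c a) (reindex c b))"
        using F(1) by blast
      show "\<exists>w z. reindex c ` cbox u v = cbox w z" for u v
        using reindex_image_cbox[OF c] by blast
      show "\<exists>w z. reindex (inv c) ` cbox u v = cbox w z" for u v
        using reindex_image_cbox[OF ic(1)] by blast
    qed (use c content_reindex_image_cbox[OF c] in auto)
    then show ?thesis
      using c ic by (simp add: reindex_image_cbox)
  qed
  have "(\<lambda>x. F (reindex c x)) integrable_on cbox a b" for a b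
    using tw by blast
  moreover have "\<exists>B>0. \<forall>a b. ball 0 B \<subseteq> cbox a b \<longrightarrow>
      norm (integral (cbox a b) (\<lambda>x. F (reindex c x)) - i) < e" if "e > 0" for e
  proof -
    obtain B where B: "B > 0" "\<And>a b. ball 0 B \<subseteq> cbox a b \<Longrightarrow> norm (integral (cbox a b) F - i) < e"
      using F(2)[OF \<open>e > 0\<close>] by blast
    have "norm (integral (cbox a b) (\<lambda>x. F (reindex c x)) - i) < e" if "ball 0 B \<subseteq> cbox a b" for a b
    proof -
      have "reindex c ` ball 0 B \<subseteq> cbox (reindex c a) (reindex c b)"
        using that c by (metis image_mono reindex_image_cbox)
      moreover have "reindex c ` ball 0 B = ball 0 B"
        using norm_reindex[OF ic(1)] by (auto simp: reindex_image_eq_vimage[OF c])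
      ultimately show ?thesis
        using B(2) integral_unique[OF tw] by simp
    qed
    then show ?thesis
      using B(1) by blast
  qed
  moreover have "(\<lambda>x. F (reindex c x)) = (\<lambda>x. if x \<in> reindex c -` S then f (reindex c x) else 0)"
    by (auto simp: F_def)
  ultimately show ?thesis
    by (subst has_integral_alt') simp
qed

lemma has_integral_reindex_iff:
  fixes c :: "'m::finite \<Rightarrow> 'n::finite" and f :: "real ^ 'm \<Rightarrow> real"
  assumes c: "bij c"
  shows "((\<lambda>x. f (reindex c x)) has_integral i) (reindex c -` S) \<longleftrightarrow> (f has_integral i) S"
proof
  assume "((\<lambda>x. f (reindex c x)) has_integral i) (reindex c -` S)"
  from has_integral_reindex[OF bij_imp_bij_inv[OF c] this] show "(f has_integral i) S"
    using c by (simp add: vimage_def)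
qed (rule has_integral_reindex[OF c])

text \<open>Conjugation by \<open>c\<close> is a sign-preserving bijection between the permutations
  of the two index types, and it matches the terms of the two Leibniz sums.\<close>

lemma det_reindex:
  fixes A :: "real ^ 'n ^ 'n" and c :: "'m::finite \<Rightarrow> 'n::finite"
  assumes c: "bij c"
  shows "det (\<chi> i j. A $ c i $ c j) = det A"
proof -
  let ?P = "map_permutation (UNIV :: 'm set) c"
  have P: "?P p x = c (p (inv c x))" for p x
    using c by (simp add: map_permutation_def restrict_id_def bij_is_surj)
  have 1: "bij_betw ?P {p. p permutes UNIV} {p. p permutes UNIV}"
  proof (rule bij_betwI[where g = "map_permutation UNIV (inv c)"])
    show "?P \<in> {p. p permutes UNIV} \<rightarrow> {p. p permutes UNIV}"
      using map_permutation_permutes[OF c] by auto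
    show "map_permutation UNIV (inv c) \<in> {p. p permutes UNIV} \<rightarrow> {p. p permutes UNIV}"
      using map_permutation_permutes[OF bij_imp_bij_inv[OF c]] by auto
  qed (use c in \<open>auto simp: map_permutation_def restrict_id_def bij_is_surj bij_is_inj
        inv_inv_eq bij_imp_bij_inv surj_f_inv_f fun_eq_iff\<close>)
  have 2: "of_int (sign (?P p)) * (\<Prod>i\<in>UNIV. A $ i $ ?P p i)
      = of_int (sign p) * (\<Prod>i\<in>UNIV. A $ c i $ c (p i))" if "p permutes UNIV" for p
  proof -
    have "sign (?P p) = sign p"
      using that c by (intro sign_map_permutation) (auto simp: bij_is_inj)
    moreover have "(\<Prod>i\<in>UNIV. A $ i $ ?P p i) = (\<Prod>i\<in>UNIV. A $ c i $ c (p i))"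
      using prod.reindex_bij_betw[OF c, of "\<lambda>i. A $ i $ ?P p i"] c by (simp add: P bij_is_inj)
    ultimately show ?thesis by simp
  qed
  show ?thesis
    unfolding det_def using 2 by (subst sum.reindex_bij_betw[OF 1, symmetric]) simp
qed


lemma absolutely_integrable_reindex_iff:
  fixes c :: "'m::finite \<Rightarrow> 'n::finite" and f :: "real ^ 'm \<Rightarrow> real"
  assumes "bij c"
  shows "(\<lambda>x. f (reindex c x)) absolutely_integrable_on (reindex c -` S) \<longleftrightarrow> f absolutely_integrable_on S"
  unfolding absolutely_integrable_on_def integrable_on_def
  using has_integral_reindex_iff[OF assms] has_integral_reindex_iff[OF assms, of "\<lambda>x. norm (f x)"]
  by simp

text \<open>The value of \<open>integral\<close> is determined by the predicate
  \<open>has_integral\<close>, including the default value in the non-integrable case, so the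
  equivalence for that predicate suffices.\<close>

lemma integral_reindex:
  fixes c :: "'m::finite \<Rightarrow> 'n::finite" and f :: "real ^ 'm \<Rightarrow> real"
  assumes "bij c"
  shows "integral (reindex c -` S) (\<lambda>x. f (reindex c x)) = integral S f"
  unfolding integral_def integrable_on_def using has_integral_reindex_iff[OF assms] by simp

text \<open>Conjugating \<open>g\<close> by the relabelling gives a map \<open>G\<close> on the
  wellordered copy with the same Jacobian determinants and a relabelled image; both sides of the
  equivalence are invariant under relabelling.\<close>

lemma has_absolute_integral_change_of_variables_open:
  fixes f :: "real ^ 'n \<Rightarrow> real" and g :: "real ^ 'n \<Rightarrow> real ^ 'n"
  assumes S: "open S"
    and der: "\<And>x. x \<in> S \<Longrightarrow> (g has_derivative g' x) (at x)"
    and inj: "inj_on g S"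
  shows "(\<lambda>x. \<bar>det (matrix (g' x))\<bar> * f (g x)) absolutely_integrable_on S \<and>
      integral S (\<lambda>x. \<bar>det (matrix (g' x))\<bar> * f (g x)) = b
    \<longleftrightarrow> f absolutely_integrable_on (g ` S) \<and> integral (g ` S) f = b"
proof -
  define c :: "'n wo_copy \<Rightarrow> 'n" where "c = Rep_wo_copy"
  have c: "bij c"
    unfolding c_def by (metis Abs_wo_copy_inverse Rep_wo_copy_inverse UNIV_I bijI')
  have d: "bij (inv c)"
    by (rule bij_imp_bij_inv[OF c])
  \<comment> \<open>The bijection \<open>c\<close> sends new indices to old ones, so
    \<open>R\<close> goes the other way, from the original space to the copy.\<close>
  define R where "R = reindex c"
  define R' where "R' = reindex (inv c)"
  have R: "linear R" "linear R'" "\<And>x. R' (R x) = x" "\<And>y. R (R' y) = y"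
    using c by (simp_all add: R_def R'_def linear_reindex)
  define G where "G = (\<lambda>y. R (g (R' y)))"
  define G' where "G' = (\<lambda>y. R \<circ> g' (R' y) \<circ> R')"
  have det: "det (matrix (G' y)) = det (matrix (g' (R' y)))" for y
  proof -
    have ax: "R' (axis j 1) = axis (c j) 1" for j
      using c by (auto simp: R'_def vec_eq_iff axis_def bij_is_inj bij_is_surj surj_f_inv_f)
    have "matrix (G' y) $ i $ j = matrix (g' (R' y)) $ c i $ c j" for i j
      by (simp add: matrix_def G'_def R_def ax)
    then have "matrix (G' y) = (\<chi> i j. matrix (g' (R' y)) $ c i $ c j)"
      by (simp add: vec_eq_iff)
    then show ?thesis
      using det_reindex[OF c] by simp
  qed
  have open': "open (R' -` S)"
    using S R(2) by (intro open_vimage linear_continuous_on) (simp_all add: linear_linear)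
  have der': "(G has_derivative G' y) (at y within R' -` S)" if "y \<in> R' -` S" for y
  proof -
    have "(g has_derivative g' (R' y)) (at (R' y))"
      using der that by simp
    then have "(R \<circ> g \<circ> R' has_derivative R \<circ> g' (R' y) \<circ> R') (at y)"
      using R(1,2) by (intro diff_chain_at linear_imp_has_derivative) (simp_all add: o_def)
    then show ?thesis
      unfolding G_def G'_def o_def by (rule has_derivative_at_withinI)
  qed
  have inj': "inj_on G (R' -` S)"
    using inj R(3,4) unfolding inj_on_def G_def by (metis vimageE)
  have image: "G ` (R' -` S) = R' -` (g ` S)"
  proof
    show "R' -` (g ` S) \<subseteq> G ` (R' -` S)"
    proof
      fix y assume "y \<in> R' -` (g ` S)"
      then obtain x where "x \<in> S" "R' y = g x"
        by auto
      then have "R x \<in> R' -` S" "y = G (R x)"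
        using R(3,4) by (simp_all add: G_def) metis
      then show "y \<in> G ` (R' -` S)"
        by blast
    qed
  qed (use R(3,4) in \<open>auto simp: G_def\<close>)
  \<comment> \<open>Scalars are embedded by \<open>vec\<close> into \<open>real ^ 1\<close>, because
    \<open>has_absolute_integral_change_of_variables\<close> treats vector-valued
    integrands.\<close>
  have "(\<lambda>y. \<bar>det (matrix (G' y))\<bar> * f (g (R' y))) absolutely_integrable_on (R' -` S) \<and>
      integral (R' -` S) (\<lambda>y. \<bar>det (matrix (G' y))\<bar> * f (g (R' y))) = b
    \<longleftrightarrow> (\<lambda>y. f (R' y)) absolutely_integrable_on (R' -` (g ` S)) \<and>
      integral (R' -` (g ` S)) (\<lambda>y. f (R' y)) = b"
    using has_absolute_integral_change_of_variables[of "R' -` S" G G' "\<lambda>y. vec (f (R' y)) :: real ^ 1" "vec b"]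
      open' der' inj' lebesgue_openin
    unfolding image by (simp add: absolutely_integrable_on_1_iff integral_on_1_eq G_def R)
  then show ?thesis
    unfolding det
    using absolutely_integrable_reindex_iff[OF d, of S "\<lambda>x. \<bar>det (matrix (g' x))\<bar> * f (g x)"]
      absolutely_integrable_reindex_iff[OF d, of "g ` S" f]
      integral_reindex[OF d, of S "\<lambda>x. \<bar>det (matrix (g' x))\<bar> * f (g x)"]
      integral_reindex[OF d, of "g ` S" f]
    by (simp add: R'_def)
qed

subsection \<open>Gradients of convex functions\<close>

text \<open>Riesz representation in finite dimension: the coordinates of the gradient are the values
  of the derivative on the basis.\<close>

lemma differentiable_imp_GDERIV:
  fixes f :: "'a::euclidean_space \<Rightarrow> real"
  assumes "f differentiable (at x)"
  shows "\<exists>D. GDERIV f x :> D"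
proof -
  obtain f' where f': "(f has_derivative f') (at x)"
    using assms by (auto simp: differentiable_def)
  then have "linear f'"
    by (rule has_derivative_linear)
  define D where "D = (\<Sum>b\<in>Basis. f' b *\<^sub>R b)"
  have "f' h = h \<bullet> D" for h
  proof -
    have "f' h = f' (\<Sum>b\<in>Basis. (h \<bullet> b) *\<^sub>R b)"
      by (simp only: euclidean_representation)
    also have "\<dots> = h \<bullet> D"
      by (simp add: linear_sum[OF \<open>linear f'\<close>] linear_scale[OF \<open>linear f'\<close>] D_def
          inner_sum_right mult.commute)
    finally show ?thesis .
  qed
  then have "f' = (\<lambda>h. h \<bullet> D)"
    by blast
  with f' have "GDERIV f x :> D"
    by (simp add: gderiv_def)
  then show ?thesis ..
qed

lemma GDERIV_unique:
  assumes "GDERIV f x :> D" "GDERIV f x :> E"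
  shows "D = E"
proof -
  have "(\<lambda>h. h \<bullet> D) = (\<lambda>h. h \<bullet> E)"
    using assms unfolding gderiv_def by (rule has_derivative_unique)
  then show ?thesis
    by (metis vector_eq_ldot)
qed

lemma gradient_eq: "GDERIV f x :> D \<Longrightarrow> gradient f x = D"
  unfolding gradient_def using GDERIV_unique by (intro the_equality)

lemma GDERIV_gradient:
  fixes f :: "'a::euclidean_space \<Rightarrow> real"
  shows "f differentiable (at x) \<Longrightarrow> GDERIV f x :> gradient f x"
  using differentiable_imp_GDERIV gradient_eq by metis

lemma GDERIV_local_eq:
  assumes "GDERIV f x :> D" "open S" "x \<in> S" "\<And>y. y \<in> S \<Longrightarrow> g y = f y"
  shows "GDERIV g x :> D"
  using assms unfolding gderiv_def by (metis has_derivative_transform_within_open)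

lemma GDERIV_along_line:
  assumes "GDERIV f x :> D"
  shows "((\<lambda>t. f (x + t *\<^sub>R d)) has_real_derivative d \<bullet> D) (at 0)"
proof -
  have "(f has_derivative (\<lambda>h. h \<bullet> D)) (at (x + 0 *\<^sub>R d))"
    using assms by (simp add: gderiv_def)
  moreover have "((\<lambda>t. x + t *\<^sub>R d) has_derivative (\<lambda>t. t *\<^sub>R d)) (at 0)"
    by (auto intro!: derivative_eq_intros)
  ultimately have "(f \<circ> (\<lambda>t. x + t *\<^sub>R d) has_derivative (\<lambda>h. h \<bullet> D) \<circ> (\<lambda>t. t *\<^sub>R d)) (at 0)"
    by (rule diff_chain_at[rotated])
  then show ?thesis
    by (simp add: o_def has_field_derivative_def mult_commute_abs)
qed

text \<open>By convexity the difference quotients at \<open>x\<close> in the direction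
  \<open>y - x\<close> stay below \<open>f y - f x\<close> for step lengths in (0,1); let the step
  tend to 0.\<close>

lemma convex_on_GDERIV_le:
  assumes f: "convex_on UNIV f" and D: "GDERIV f x :> D"
  shows "f x + D \<bullet> (y - x) \<le> f y"
proof -
  let ?h = "\<lambda>t. (f (x + t *\<^sub>R (y - x)) - f x) / t"
  have "(?h \<longlongrightarrow> (y - x) \<bullet> D) (at 0)"
    using GDERIV_along_line[OF D, of "y - x"] by (simp add: DERIV_def)
  then have "(?h \<longlongrightarrow> (y - x) \<bullet> D) (at_right 0)"
    by (rule filterlim_mono) (auto simp: at_within_le_at)
  moreover have "\<forall>\<^sub>F t in at_right 0. ?h t \<le> f y - f x"
    unfolding eventually_at_right_field
  proof (intro exI conjI allI impI)
    fix t :: real assume t: "0 < t" "t < 1"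
    have "f ((1 - t) *\<^sub>R x + t *\<^sub>R y) \<le> (1 - t) * f x + t * f y"
      using convex_onD[OF f] t by simp
    moreover have "(1 - t) *\<^sub>R x + t *\<^sub>R y = x + t *\<^sub>R (y - x)"
      by (simp add: algebra_simps)
    ultimately show "?h t \<le> f y - f x"
      using t by (simp add: field_simps)
  qed simp
  ultimately have "(y - x) \<bullet> D \<le> f y - f x"
    by (rule tendsto_upperbound) simp
  then show ?thesis
    by (simp add: inner_commute)
qed

text \<open>Subtracting the linear function of \<open>p\<close> from \<open>f\<close> leaves a
  function that is minimal over \<open>S\<close> at \<open>x\<close>, so its derivative vanishes
  there. The local form matters later, when subgradient inequalities are known only on the source
  set.\<close>

lemma GDERIV_subgradient_eq:
  assumes D: "GDERIV f x :> D" and S: "open S" "x \<in> S"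
    and sub: "\<And>y. y \<in> S \<Longrightarrow> f x + p \<bullet> (y - x) \<le> f y"
  shows "p = D"
proof -
  have "((\<lambda>y. f y - p \<bullet> y) has_derivative (\<lambda>h. h \<bullet> D - p \<bullet> h)) (at x)"
    using D unfolding gderiv_def by (intro derivative_eq_intros) auto
  moreover have "f x - p \<bullet> x \<le> f y - p \<bullet> y" if "y \<in> S" for y
    using sub[OF that] by (simp add: inner_diff_right)
  ultimately have "(\<lambda>h. h \<bullet> D - p \<bullet> h) = (\<lambda>h. 0)"
    using differential_zero_maxmin[of x S "\<lambda>y. f y - p \<bullet> y"] S by blast
  then have "h \<bullet> D = h \<bullet> p" for h
    by (metis eq_iff_diff_eq_0 inner_commute)
  then show ?thesis
    by (metis vector_eq_ldot)
qed

text \<open>If \<open>T x = T y\<close>, then \<open>f\<close> is affine along the segment with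
  \<open>T x\<close> as a subgradient throughout, so \<open>T\<close> is constant near its start and
  \<open>H x\<close> annihilates \<open>y - x\<close>. Only an initial piece of the segment is used,
  as \<open>S\<close> may fail to be convex.\<close>

lemma inj_on_gradient_of_convex:
  fixes f :: "real ^ 'n \<Rightarrow> real"
  assumes S: "open S" and f: "convex_on UNIV f"
    and D: "\<And>x. x \<in> S \<Longrightarrow> GDERIV f x :> T x"
    and H: "\<And>x. x \<in> S \<Longrightarrow> (T has_derivative (\<lambda>h. H x *v h)) (at x)"
    and det: "\<And>x. x \<in> S \<Longrightarrow> det (H x) \<noteq> 0"
  shows "inj_on T S"
proof (rule inj_onI, rule ccontr)
  fix x y assume xy: "x \<in> S" "y \<in> S" "T x = T y" "x \<noteq> y"
  have sub: "f z + T z \<bullet> (w - z) \<le> f w" if "z \<in> S" for z w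
    using convex_on_GDERIV_le[OF f D[OF that]] .
  define d where "d = y - x"
  obtain e where e: "e > 0" "ball x e \<subseteq> S"
    using S xy(1) openE by blast
  \<comment> \<open>For \<open>t\<close> below this bound the point \<open>x + t *\<^sub>R d\<close>
    lies both in the ball and on the segment from \<open>x\<close> to \<open>y\<close>.\<close>
  define \<epsilon> where "\<epsilon> = min 1 (e / norm d)"
  have d: "d \<noteq> 0"
    using xy(4) by (simp add: d_def)
  have \<epsilon>: "\<epsilon> > 0" "\<epsilon> \<le> 1" "\<epsilon> * norm d \<le> e"
    using e(1) d by (auto simp: \<epsilon>_def min_def field_simps)
  have const: "T (x + t *\<^sub>R d) = T x" if t: "0 \<le> t" "t < \<epsilon>" for t
  proof -
    let ?z = "x + t *\<^sub>R d"
    have "t * norm d < \<epsilon> * norm d"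
      using t(2) d by simp
    then have "?z \<in> S"
      using \<epsilon> t(1) e(2) by (intro subsetD[OF e(2)]) (simp add: dist_norm)
    have "f y = f x + T x \<bullet> d"
      using sub[OF xy(1), of y] sub[OF xy(2), of x] xy(3)
      by (simp add: d_def inner_diff_right)
    moreover have "?z = (1 - t) *\<^sub>R x + t *\<^sub>R y"
      by (simp add: d_def algebra_simps)
    then have "f ?z \<le> (1 - t) * f x + t * f y"
      using convex_onD[OF f, of t x y] t \<epsilon>(2) by simp
    ultimately have z: "f ?z \<le> f x + t * (T x \<bullet> d)"
      by (simp add: algebra_simps)
    \<comment> \<open>At \<open>?z\<close> the function does not exceed its supporting plane at
      \<open>x\<close>, so \<open>T x\<close> is a subgradient at \<open>?z\<close> too, hence the
      gradient there.\<close>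
    have "f ?z + T x \<bullet> (w - ?z) \<le> f w" for w
      using z sub[OF xy(1), of w] by (simp add: inner_diff_right inner_add_right)
    with D[OF \<open>?z \<in> S\<close>] show ?thesis
      using GDERIV_subgradient_eq[OF _ open_UNIV UNIV_I] by metis
  qed
  have "((\<lambda>t. x + t *\<^sub>R d) has_derivative (\<lambda>t. t *\<^sub>R d)) (at 0)"
    by (auto intro!: derivative_eq_intros)
  moreover have "(T has_derivative (\<lambda>h. H x *v h)) (at (x + 0 *\<^sub>R d))"
    using H[OF xy(1)] by simp
  ultimately have "(T \<circ> (\<lambda>t. x + t *\<^sub>R d) has_derivative (\<lambda>h. H x *v h) \<circ> (\<lambda>t. t *\<^sub>R d)) (at 0)"
    by (rule diff_chain_at)
  then have "((\<lambda>t. T (x + t *\<^sub>R d)) has_vector_derivative H x *v d) (at 0)"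
    by (simp add: o_def has_vector_derivative_def matrix_vector_mult_scaleR)
  \<comment> \<open>Constancy is known only for \<open>t \<ge> 0\<close>, hence the passage to
    one-sided derivatives.\<close>
  then have "((\<lambda>t. T (x + t *\<^sub>R d)) has_vector_derivative H x *v d) (at 0 within {0..\<epsilon>/2})"
    by (rule has_vector_derivative_at_within)
  moreover have "((\<lambda>t. T (x + t *\<^sub>R d)) has_vector_derivative 0) (at 0 within {0..\<epsilon>/2})"
    by (rule has_vector_derivative_transform[where f = "\<lambda>t. T x"]) (use \<epsilon> const in auto)
  moreover have "at 0 within {0..\<epsilon>/2} \<noteq> bot"
    using \<epsilon> trivial_limit_within[of 0 "{0..\<epsilon>/2}"] islimpt_Icc[of 0 "\<epsilon>/2" 0] by simp
  ultimately have "H x *v d = 0"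
    by (metis vector_derivative_unique_within)
  moreover have "invertible (H x)"
    using det[OF xy(1)] by (simp add: invertible_det_nz)
  ultimately show False
    using d by (metis invertible_left_inverse matrix_left_invertible_ker)
qed

text \<open>Since \<open>H\<close> is not assumed continuous, openness comes from Sussmann's open
  mapping theorem, applied at each point with a right inverse of the derivative.\<close>

lemma open_image_nonsingular:
  fixes T :: "real ^ 'n \<Rightarrow> real ^ 'n"
  assumes S: "open S"
    and H: "\<And>x. x \<in> S \<Longrightarrow> (T has_derivative (\<lambda>h. H x *v h)) (at x)"
    and det: "\<And>x. x \<in> S \<Longrightarrow> det (H x) \<noteq> 0"
  shows "open (T ` S)"
proof -
  have "T x \<in> interior (T ` S)" if x: "x \<in> S" for x
  proof -
    obtain B where B: "H x ** B = mat 1"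
      using det[OF x] by (meson invertible_def invertible_det_nz)
    show ?thesis
    proof (rule sussmann_open_mapping[OF S _ x H[OF x]])
      show "continuous_on S T"
        using H by (meson continuous_at_imp_continuous_on has_derivative_continuous)
      show "(\<lambda>h. H x *v h) \<circ> (\<lambda>h. B *v h) = id"
        using B by (simp add: o_def fun_eq_iff matrix_vector_mul_assoc)
    qed (use S x in \<open>auto simp: interior_open\<close>)
  qed
  then show ?thesis
    by (metis image_subsetI interior_subset open_subset_interior order_antisym open_interior)
qed

subsection \<open>Transport maps\<close>

lemma continuous_bounded_imp_absolutely_integrable:
  fixes h :: "'a::euclidean_space \<Rightarrow> real"
  assumes S: "open S" "bounded S" and h: "continuous_on S h" "\<And>x. x \<in> S \<Longrightarrow> \<bar>h x\<bar> \<le> B"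
  shows "h absolutely_integrable_on S"
proof (rule measurable_bounded_by_integrable_imp_absolutely_integrable)
  have "S \<in> lmeasurable"
    using S by (simp add: lmeasurable_open)
  then show "S \<in> sets lebesgue" "(\<lambda>x. B) integrable_on S"
    by (simp_all add: fmeasurableD integrable_on_const)
  then show "h \<in> borel_measurable (lebesgue_on S)"
    using h(1) by (intro continuous_imp_measurable_on_sets_lebesgue)
qed (use h(2) in auto)

text \<open>On a closed box around \<open>x\<close> inside \<open>S\<close> the integral is squeezed
  between 0 and the integral over \<open>S\<close>; a continuous nonnegative function with zero
  integral on a box vanishes.\<close>

lemma integral_0_imp_eq_0_open:
  fixes h :: "'a::euclidean_space \<Rightarrow> real"
  assumes S: "open S" and h: "continuous_on S h" "\<And>x. x \<in> S \<Longrightarrow> 0 \<le> h x"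
    and int: "h integrable_on S" "integral S h \<le> 0" and x: "x \<in> S"
  shows "h x = 0"
proof -
  obtain a b where ab: "x \<in> box a b" "cbox a b \<subseteq> S"
    using S x by (meson open_contains_cbox)
  have int': "h integrable_on cbox a b"
    using h(1) ab(2) by (intro integrable_continuous) (rule continuous_on_subset)
  have "integral (cbox a b) h \<le> integral S h"
    using ab(2) int' int(1) h(2) by (intro integral_subset_le) auto
  moreover have "0 \<le> integral (cbox a b) h"
    using int' ab(2) h(2) by (intro integral_nonneg) auto
  ultimately have "(h has_integral 0) (cbox a b)"
    using int' int(2) by (simp add: has_integral_iff)
  then show ?thesis
    using ab h by (intro has_integral_0_cbox_imp_0[of a b h])
       (auto intro: continuous_on_subset dest: subsetD[OF box_subset_cbox])
qed

text \<open>By change of variables, \<open>det (H x) * g (T x)\<close> integrates to the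
  \<open>g\<close>-mass of the image, which is at most the total mass of \<open>f\<close>, yet it
  dominates \<open>f\<close> pointwise. Hence the two densities agree and the image misses only a
  null set of \<open>\<Lambda>\<close>.\<close>

lemma pushforward_of_det_ge:
  fixes \<Omega> \<Lambda> :: "(real ^ 'n) set" and f g :: "real ^ 'n \<Rightarrow> real" and T :: "real ^ 'n \<Rightarrow> real ^ 'n"
  assumes \<Omega>: "open \<Omega>" "bounded \<Omega>" and \<Lambda>: "open \<Lambda>" "bounded \<Lambda>"
    and f: "continuous_on \<Omega> f" "\<And>x. x \<in> \<Omega> \<Longrightarrow> 0 < f x" "\<And>x. x \<in> \<Omega> \<Longrightarrow> f x \<le> Cf"
    and g: "continuous_on \<Lambda> g" "0 < cg" "\<And>y. y \<in> \<Lambda> \<Longrightarrow> cg \<le> g y" "\<And>y. y \<in> \<Lambda> \<Longrightarrow> g y \<le> Cg"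
    and mass: "integral \<Omega> f = integral \<Lambda> g"
    and T: "T ` \<Omega> \<subseteq> \<Lambda>" "inj_on T \<Omega>"
    and H: "\<And>x. x \<in> \<Omega> \<Longrightarrow> (T has_derivative (\<lambda>h. H x *v h)) (at x)"
    and D: "continuous_on \<Omega> (\<lambda>x. det (H x))"
    and ge: "\<And>x. x \<in> \<Omega> \<Longrightarrow> f x / g (T x) \<le> det (H x)"
  shows "\<And>h. continuous_on \<Lambda> h \<Longrightarrow> (\<And>y. y \<in> \<Lambda> \<Longrightarrow> \<bar>h y\<bar> \<le> B) \<Longrightarrow>
      integral \<Omega> (\<lambda>x. h (T x) * f x) = integral \<Lambda> (\<lambda>y. h y * g y)"
    and "\<Lambda> \<subseteq> closure (T ` \<Omega>)"
proof -
  have gpos: "0 < g y" if "y \<in> \<Lambda>" for y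
    using g(2) g(3)[OF that] by simp
  have Dpos: "0 < det (H x)" if "x \<in> \<Omega>" for x
    using ge[OF that] f(2)[OF that] gpos[of "T x"] T(1) that
    by (smt (verit) divide_pos_pos image_subset_iff)
  have contT: "continuous_on \<Omega> T"
    using H by (meson continuous_at_imp_continuous_on has_derivative_continuous)
  have fint: "f absolutely_integrable_on \<Omega>"
    using f by (intro continuous_bounded_imp_absolutely_integrable[OF \<Omega>, of _ Cf]) fastforce+
  have gint: "g absolutely_integrable_on \<Lambda>"
    using g gpos by (intro continuous_bounded_imp_absolutely_integrable[OF \<Lambda>, of _ Cg]) fastforce+
  \<comment> \<open>Openness makes the image measurable, so integrability restricts to it from
    \<open>\<Lambda>\<close>.\<close>
  have opT: "open (T ` \<Omega>)"
    by (rule open_image_nonsingular[OF \<Omega>(1) H]) (use Dpos in force)+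
  have subset_int: "h absolutely_integrable_on (T ` \<Omega>)" if "h absolutely_integrable_on \<Lambda>"
    for h :: "real ^ 'n \<Rightarrow> real"
    using set_integrable_subset[OF that _ T(1)] opT by (simp add: lebesgue_openin)
  have cov: "(\<lambda>x. det (H x) * h (T x)) absolutely_integrable_on \<Omega>"
      "integral \<Omega> (\<lambda>x. det (H x) * h (T x)) = integral (T ` \<Omega>) h"
    if "h absolutely_integrable_on \<Lambda>" for h
  proof -
    have 1: "\<bar>det (matrix (\<lambda>h. H x *v h))\<bar> = det (H x)" if "x \<in> \<Omega>" for x
      using Dpos[OF that] by simp
    have "(\<lambda>x. \<bar>det (matrix (\<lambda>h. H x *v h))\<bar> * h (T x)) absolutely_integrable_on \<Omega> \<and>
        integral \<Omega> (\<lambda>x. \<bar>det (matrix (\<lambda>h. H x *v h))\<bar> * h (T x)) = integral (T ` \<Omega>) h"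
      using subset_int[OF that]
      by (subst has_absolute_integral_change_of_variables_open[OF \<Omega>(1) H T(2)]) auto
    then show "(\<lambda>x. det (H x) * h (T x)) absolutely_integrable_on \<Omega>"
      "integral \<Omega> (\<lambda>x. det (H x) * h (T x)) = integral (T ` \<Omega>) h"
      using 1 by (auto cong: integral_cong set_integrable_cong)
  qed
  have le: "integral (T ` \<Omega>) g \<le> integral \<Lambda> g"
    using gint subset_int[OF gint] gpos T(1)
    by (intro integral_subset_le) (auto simp: absolutely_integrable_on_def less_imp_le)
  \<comment> \<open>The excess density is continuous and nonnegative, and its integral is at most 0
    by \<open>le\<close> and \<open>mass\<close>.\<close>
  define k where "k = (\<lambda>x. det (H x) * g (T x) - f x)"
  have k: "k integrable_on \<Omega>" "integral \<Omega> k = integral (T ` \<Omega>) g - integral \<Omega> f"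
    using cov[OF gint] fint unfolding k_def
    by (auto intro!: integrable_diff simp: integral_diff set_lebesgue_integral_eq_integral(1))
  have kz: "k x = 0" if "x \<in> \<Omega>" for x
  proof (rule integral_0_imp_eq_0_open[OF \<Omega>(1) _ _ k(1) _ that])
    show "continuous_on \<Omega> k"
      unfolding k_def using T(1)
      by (intro continuous_intros D f(1) continuous_on_compose2[OF g(1) contT])
    show "0 \<le> k x" if "x \<in> \<Omega>" for x
      using ge[OF that] gpos[of "T x"] T(1) that by (auto simp: k_def field_simps)
    show "integral \<Omega> k \<le> 0"
      using k(2) le mass by simp
  qed
  have "integral \<Omega> k = 0"
    using kz by (metis integral_0 integral_cong)
  then have eq: "integral (T ` \<Omega>) g = integral \<Lambda> g"
    using k(2) mass by simp
  \<comment> \<open>The part of \<open>\<Lambda>\<close> missed by the image carries no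
    \<open>g\<close>-mass, and \<open>g \<ge> cg > 0\<close> turns this into Lebesgue measure
    zero.\<close>
  let ?N = "\<Lambda> - T ` \<Omega>"
  have N: "?N \<in> lmeasurable"
    using \<Lambda> opT by (intro fmeasurable_Diff) (simp_all add: lmeasurable_open lebesgue_openin)
  have gN: "g integrable_on ?N" "integral ?N g = 0"
    using integral_setdiff[of g \<Lambda> "T ` \<Omega>"] integrable_setdiff[of g _ \<Lambda> _ "T ` \<Omega>"]
      gint subset_int[OF gint] T(1) eq
    by (auto simp: absolutely_integrable_on_def has_integral_iff negligible_subset Diff_eq_empty_iff[THEN iffD2])
  have "cg * measure lebesgue ?N = integral ?N (\<lambda>y. cg)"
    using N by (simp add: lmeasure_integral flip: integral_mult_right)
  also have "\<dots> \<le> integral ?N g"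
    using N gN(1) g(3) by (intro integral_le) (auto intro: integrable_on_const)
  finally have "measure lebesgue ?N \<le> 0"
    using g(2) gN(2) by (simp add: mult_le_0_iff)
  then have negl: "negligible ?N"
    using N by (simp add: negligible_iff_measure0 measure_le_0_iff)
  show "integral \<Omega> (\<lambda>x. h (T x) * f x) = integral \<Lambda> (\<lambda>y. h y * g y)"
    if h: "continuous_on \<Lambda> h" "\<And>y. y \<in> \<Lambda> \<Longrightarrow> \<bar>h y\<bar> \<le> B" for h
  proof -
    have hg: "(\<lambda>y. h y * g y) absolutely_integrable_on \<Lambda>"
    proof (rule continuous_bounded_imp_absolutely_integrable[OF \<Lambda>])
      show "\<bar>h y * g y\<bar> \<le> B * Cg" if "y \<in> \<Lambda>" for y
        using h(2)[OF that] g(4)[OF that] gpos[OF that] by (simp add: abs_mult mult_mono)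
    qed (intro continuous_intros h(1) g(1))
    have "integral \<Omega> (\<lambda>x. h (T x) * f x) = integral \<Omega> (\<lambda>x. det (H x) * (h (T x) * g (T x)))"
      using kz by (intro integral_cong) (simp add: k_def)
    also have "\<dots> = integral (T ` \<Omega>) (\<lambda>y. h y * g y)"
      by (rule cov(2)[OF hg])
    also have "\<dots> = integral \<Lambda> (\<lambda>y. h y * g y)"
      using negl T(1) by (intro integral_spike_set) (auto elim!: negligible_subset)
    finally show ?thesis .
  qed
  show "\<Lambda> \<subseteq> closure (T ` \<Omega>)"
  proof (rule ccontr)
    assume "\<not> \<Lambda> \<subseteq> closure (T ` \<Omega>)"
    then have "\<Lambda> - closure (T ` \<Omega>) \<noteq> {}"
      by blast
    moreover have "open (\<Lambda> - closure (T ` \<Omega>))"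
      using \<Lambda>(1) by (simp add: open_Diff)
    moreover have "negligible (\<Lambda> - closure (T ` \<Omega>))"
      using negl by (rule negligible_subset) (use closure_subset[of "T ` \<Omega>"] in blast)
    ultimately show False
      by (metis open_not_negligible)
  qed
qed

section \<open>Legendre transforms over a bounded set, and comparison of potentials through
  them\<close>

definition legendre_on :: "'a::real_inner set \<Rightarrow> ('a \<Rightarrow> real) \<Rightarrow> 'a \<Rightarrow> real" where
  "legendre_on S F y = (SUP x\<in>S. x \<bullet> y - F x)"

lemma convex_on_UNIV_imp_continuous:
  fixes F :: "'a::euclidean_space \<Rightarrow> real"
  shows "convex_on UNIV F \<Longrightarrow> continuous_on A F"
  by (rule continuous_on_subset[OF convex_on_continuous[OF open_UNIV] subset_UNIV])

lemma continuous_on_UNIV_imp_bounded: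
  fixes h :: "'a::euclidean_space \<Rightarrow> real"
  assumes "continuous_on UNIV h" "bounded S"
  shows "\<exists>B. \<forall>x\<in>S. \<bar>h x\<bar> \<le> B"
proof -
  have "bounded (h ` closure S)"
    using assms by (intro compact_imp_bounded compact_continuous_image)
      (auto intro: continuous_on_subset)
  then show ?thesis
    using closure_subset by (auto simp: bounded_iff)
qed

text \<open>Restricting the supremum to a bounded set keeps it finite at every \<open>y\<close>,
  since a continuous function is bounded on the compact closure of \<open>S\<close>.\<close>

lemma bdd_above_legendre:
  fixes F :: "'a::euclidean_space \<Rightarrow> real"
  assumes "convex_on UNIV F" "bounded S"
  shows "bdd_above ((\<lambda>x. x \<bullet> y - F x) ` S)"
proof -
  have "continuous_on UNIV (\<lambda>x. x \<bullet> y - F x)"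
    by (intro continuous_intros convex_on_UNIV_imp_continuous assms)
  from continuous_on_UNIV_imp_bounded[OF this assms(2)]
  obtain B where "\<And>x. x \<in> S \<Longrightarrow> x \<bullet> y - F x \<le> B"
    by (metis abs_le_D1)
  then show ?thesis
    by (rule bdd_aboveI2)
qed

lemma legendre_on_upper:
  fixes F :: "'a::euclidean_space \<Rightarrow> real"
  assumes "convex_on UNIV F" "bounded S" "x \<in> S"
  shows "x \<bullet> y - F x \<le> legendre_on S F y"
  unfolding legendre_on_def by (rule cSUP_upper[OF assms(3) bdd_above_legendre[OF assms(1,2)]])

text \<open>Fenchel equality: the subgradient inequality on \<open>S\<close> says exactly that
  \<open>x\<close> attains the supremum at \<open>p\<close>.\<close>

lemma legendre_on_subgradient:
  fixes F :: "'a::euclidean_space \<Rightarrow> real"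
  assumes "convex_on UNIV F" "bounded S" "x \<in> S" "\<And>z. z \<in> S \<Longrightarrow> F x + p \<bullet> (z - x) \<le> F z"
  shows "legendre_on S F p = x \<bullet> p - F x"
proof (rule antisym)
  show "legendre_on S F p \<le> x \<bullet> p - F x"
    unfolding legendre_on_def
  proof (rule cSUP_least)
    show "z \<bullet> p - F z \<le> x \<bullet> p - F x" if "z \<in> S" for z
      using assms(4)[OF that] by (simp add: inner_diff_right inner_commute)
  qed (use assms(3) in blast)
qed (rule legendre_on_upper[OF assms(1-3)])

text \<open>A supremum of affine functions of \<open>y\<close> is convex; being finite on the whole
  space it is then continuous, which the integration and limit arguments use.\<close>

lemma convex_on_legendre:
  fixes F :: "'a::euclidean_space \<Rightarrow> real"
  assumes F: "convex_on UNIV F" and S: "bounded S" "S \<noteq> {}"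
  shows "convex_on UNIV (legendre_on S F)"
proof (rule convex_onI)
  fix t :: real and y z :: 'a
  assume t: "0 < t" "t < 1"
  show "legendre_on S F ((1 - t) *\<^sub>R y + t *\<^sub>R z) \<le> (1 - t) * legendre_on S F y + t * legendre_on S F z"
    unfolding legendre_on_def[of S F "(1 - t) *\<^sub>R y + t *\<^sub>R z"]
  proof (rule cSUP_least[OF S(2)])
    fix x assume x: "x \<in> S"
    have "x \<bullet> ((1 - t) *\<^sub>R y + t *\<^sub>R z) - F x = (1 - t) * (x \<bullet> y - F x) + t * (x \<bullet> z - F x)"
      by (simp add: inner_add_right algebra_simps)
    also have "\<dots> \<le> (1 - t) * legendre_on S F y + t * legendre_on S F z"
      using t x legendre_on_upper[OF F S(1)] by (intro add_mono mult_left_mono) auto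
    finally show "x \<bullet> ((1 - t) *\<^sub>R y + t *\<^sub>R z) - F x \<le> (1 - t) * legendre_on S F y + t * legendre_on S F z" .
  qed
qed simp

text \<open>The gap of the dual pair of each potential along the other map is nonnegative, while both gaps
  together integrate to zero because the two maps push forward to the same measure.\<close>

lemma gradient_maps_eq:
  fixes f F1 F2 :: "'a::euclidean_space \<Rightarrow> real"
  assumes S: "open S" "bounded S"
    and f: "continuous_on S f" "\<And>x. x \<in> S \<Longrightarrow> 0 < f x" "\<And>x. x \<in> S \<Longrightarrow> f x \<le> C"
    and F: "convex_on UNIV F1" "convex_on UNIV F2"
    and T: "\<And>x. x \<in> S \<Longrightarrow> GDERIV F1 x :> T1 x" "\<And>x. x \<in> S \<Longrightarrow> GDERIV F2 x :> T2 x"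
      "continuous_on S T1" "continuous_on S T2" "bounded (T1 ` S)" "bounded (T2 ` S)"
    and push: "\<And>h. continuous_on UNIV h \<Longrightarrow>
      integral S (\<lambda>x. h (T1 x) * f x) = integral S (\<lambda>x. h (T2 x) * f x)"
    and x: "x \<in> S"
  shows "T1 x = T2 x"
proof -
  define u where "u = legendre_on S F1"
  define v where "v = legendre_on S F2"
  have ne: "S \<noteq> {}"
    using x by blast
  have uv: "continuous_on UNIV u" "continuous_on UNIV v"
    unfolding u_def v_def
    by (intro convex_on_UNIV_imp_continuous convex_on_legendre F S(2) ne)+
  have int: "(\<lambda>x. h (T x) * f x) integrable_on S"
    if h: "continuous_on UNIV h" and T: "continuous_on S T" "bounded (T ` S)" for h :: "'a \<Rightarrow> real" and T
  proof -
    obtain B where B: "\<forall>y\<in>T ` S. \<bar>h y\<bar> \<le> B"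
      using continuous_on_UNIV_imp_bounded[OF h T(2)] by blast
    have "(\<lambda>x. h (T x) * f x) absolutely_integrable_on S"
    proof (rule continuous_bounded_imp_absolutely_integrable[OF S])
      show "continuous_on S (\<lambda>x. h (T x) * f x)"
        by (intro continuous_intros f(1) continuous_on_compose2[OF h T(1)]) simp
      show "\<bar>h (T x) * f x\<bar> \<le> B * C" if "x \<in> S" for x
        using B f(2,3)[OF that] that by (fastforce simp: abs_mult intro!: mult_mono)
    qed
    then show ?thesis
      by (simp add: absolutely_integrable_on_def)
  qed
  have gap: "0 \<le> F1 x + u y - x \<bullet> y" "0 \<le> F2 x + v y - x \<bullet> y" if "x \<in> S" for x y
    using legendre_on_upper[OF F(1) S(2) that, of y] legendre_on_upper[OF F(2) S(2) that, of y]
    by (simp_all add: u_def v_def)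
  have tight: "F1 x + u (T1 x) - x \<bullet> T1 x = 0" "F2 x + v (T2 x) - x \<bullet> T2 x = 0" if "x \<in> S" for x
    using legendre_on_subgradient[OF F(1) S(2) that convex_on_GDERIV_le[OF F(1) T(1)[OF that]]]
      legendre_on_subgradient[OF F(2) S(2) that convex_on_GDERIV_le[OF F(2) T(2)[OF that]]]
    by (simp_all add: u_def v_def)
  \<comment> \<open>Here \<open>k\<close> adds the two cross gaps, each potential tested with the
    map of the other. Subtracting the tight gaps turns it into \<open>l\<close>, which involves only
    \<open>u\<close> and \<open>v\<close> composed with the maps, so \<open>push\<close>
    applies.\<close>
  define k where "k = (\<lambda>x. ((F1 x + u (T2 x) - x \<bullet> T2 x) + (F2 x + v (T1 x) - x \<bullet> T1 x)) * f x)"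
  define l where "l = (\<lambda>x. (u (T2 x) * f x - u (T1 x) * f x) + (v (T1 x) * f x - v (T2 x) * f x))"
  have kl: "k x = l x" if "x \<in> S" for x
  proof -
    have "k x - l x = ((F1 x + u (T1 x) - x \<bullet> T1 x) + (F2 x + v (T2 x) - x \<bullet> T2 x)) * f x"
      by (simp add: k_def l_def algebra_simps)
    then show ?thesis
      using tight[OF that] by simp
  qed
  have "(l has_integral (integral S (\<lambda>x. u (T2 x) * f x) - integral S (\<lambda>x. u (T1 x) * f x))
      + (integral S (\<lambda>x. v (T1 x) * f x) - integral S (\<lambda>x. v (T2 x) * f x))) S"
    unfolding l_def
    by (intro has_integral_add has_integral_diff integrable_integral int uv T(3-6))
  then have l: "l integrable_on S" "integral S l = 0"
    using push[OF uv(1)] push[OF uv(2)] by (simp_all add: has_integral_iff)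
  have "k x = 0"
  proof (rule integral_0_imp_eq_0_open[OF S(1) _ _ _ _ x])
    show "continuous_on S k"
      unfolding k_def
      by (intro continuous_intros f(1) T(3,4) convex_on_UNIV_imp_continuous F
          continuous_on_compose2[OF uv(1) T(4)] continuous_on_compose2[OF uv(2) T(3)]) simp_all
    show "0 \<le> k x" if "x \<in> S" for x
      unfolding k_def using gap[OF that] f(2)[OF that] by (intro mult_nonneg_nonneg) (auto intro: add_nonneg_nonneg)
    show "k integrable_on S"
      using l(1) kl integrable_cong by metis
    have "integral S k = integral S l"
      by (rule integral_cong) (rule kl)
    then show "integral S k \<le> 0"
      using l(2) by simp
  qed
  \<comment> \<open>Two nonnegative gaps weighted by \<open>f x > 0\<close> add up to zero, so each
    vanishes; the first one makes \<open>T2 x\<close> a subgradient of \<open>F1\<close> at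
    \<open>x\<close> relative to \<open>S\<close>.\<close>
  then have "F1 x + u (T2 x) - x \<bullet> T2 x = 0"
    using gap(1)[OF x, of "T2 x"] gap(2)[OF x, of "T1 x"] f(2)[OF x] by (simp add: k_def)
  then have "F1 x + T2 x \<bullet> (z - x) \<le> F1 z" if "z \<in> S" for z
    using gap(1)[OF that, of "T2 x"] by (simp add: inner_diff_right inner_commute)
  then show ?thesis
    using GDERIV_subgradient_eq[OF T(1)[OF x] S(1) x] by metis
qed

text \<open>Refining a partition of the segment makes the upper and lower Riemann sums of the common
  subgradient agree in the limit.\<close>

lemma common_subgradients_imp_diff_const:
  fixes u v :: "'a::real_inner \<Rightarrow> real"
  assumes C: "convex C" "a \<in> C" "b \<in> C"
    and h: "\<And>y. y \<in> C \<Longrightarrow> \<exists>p. (\<forall>z. u y + p \<bullet> (z - y) \<le> u z) \<and> (\<forall>z. v y + p \<bullet> (z - y) \<le> v z)"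
  shows "u a - v a = u b - v b"
proof -
  obtain p where p: "\<And>y z. y \<in> C \<Longrightarrow> u y + p y \<bullet> (z - y) \<le> u z" "\<And>y z. y \<in> C \<Longrightarrow> v y + p y \<bullet> (z - y) \<le> v z"
    using h by metis
  define w where "w = (\<lambda>y. u y - v y)"
  \<comment> \<open>The subgradients at \<open>y\<close> and \<open>z\<close> enclose the increments
    of \<open>u\<close> and of \<open>v\<close> in the same interval, so these differ by at most its
    length.\<close>
  have step: "\<bar>w z - w y\<bar> \<le> p z \<bullet> (z - y) - p y \<bullet> (z - y)" if "y \<in> C" "z \<in> C" for y z
    using p[OF that(1), of z] p[OF that(2), of y] by (auto simp: w_def inner_diff_right)
  have bound: "\<bar>w b - w a\<bar> \<le> (p b \<bullet> (b - a) - p a \<bullet> (b - a)) / real n" if n: "n > 0" for n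
  proof -
    define y where "y = (\<lambda>i. a + (real i / real n) *\<^sub>R (b - a))"
    have y: "y i \<in> C" if "i \<le> n" for i
    proof -
      have "y i = (1 - real i / real n) *\<^sub>R a + (real i / real n) *\<^sub>R b"
        by (simp add: y_def algebra_simps)
      then show ?thesis
        using convexD[OF C(1) C(2,3), of "1 - real i / real n" "real i / real n"] that n by simp
    qed
    have dy: "y (Suc i) - y i = (1 / real n) *\<^sub>R (b - a)" for i
      by (simp add: y_def add_divide_distrib flip: scaleR_diff_left)
    have ends: "y 0 = a" "y n = b"
      using n by (simp_all add: y_def)
    have "\<bar>w b - w a\<bar> = \<bar>\<Sum>i<n. w (y (Suc i)) - w (y i)\<bar>"
      by (simp add: sum_lessThan_telescope[of "\<lambda>i. w (y i)"] ends)
    also have "\<dots> \<le> (\<Sum>i<n. \<bar>w (y (Suc i)) - w (y i)\<bar>)"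
      by (rule sum_abs)
    \<comment> \<open>With equal steps the interval lengths telescope as well, leaving the values of
      \<open>p\<close> at the two ends divided by \<open>n\<close>.\<close>
    also have "\<dots> \<le> (\<Sum>i<n. p (y (Suc i)) \<bullet> (b - a) / real n - p (y i) \<bullet> (b - a) / real n)"
    proof (rule sum_mono)
      fix i assume "i \<in> {..<n}"
      then show "\<bar>w (y (Suc i)) - w (y i)\<bar> \<le> p (y (Suc i)) \<bullet> (b - a) / real n - p (y i) \<bullet> (b - a) / real n"
        using step[OF y y, of i "Suc i"] by (simp add: dy)
    qed
    also have "\<dots> = (p b \<bullet> (b - a) - p a \<bullet> (b - a)) / real n"
      by (simp add: sum_lessThan_telescope[of "\<lambda>i. p (y i) \<bullet> (b - a) / real n"] ends diff_divide_distrib)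
    finally show ?thesis .
  qed
  have "(\<lambda>n. (p b \<bullet> (b - a) - p a \<bullet> (b - a)) / real n) \<longlonglongrightarrow> 0"
    by (rule lim_const_over_n)
  then have "\<bar>w b - w a\<bar> \<le> 0"
    by (rule tendsto_lowerbound) (use bound in \<open>auto simp: eventually_sequentially intro!: exI[of _ 1]\<close>)
  then show ?thesis
    by (simp add: w_def)
qed

text \<open>At \<open>T x\<close> both transforms have the subgradient \<open>x\<close>. Density of
  the image and compactness extend this to a common subgradient at every point of \<open>C\<close>,
  so the transforms differ by a constant on \<open>C\<close>; Fenchel equality carries it back to
  \<open>S\<close>, connected or not.\<close>

lemma potentials_diff_const:
  fixes F1 F2 :: "'a::euclidean_space \<Rightarrow> real"
  assumes S: "bounded S" and C: "convex C" "T ` S \<subseteq> C" "C \<subseteq> closure (T ` S)"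
    and F: "convex_on UNIV F1" "convex_on UNIV F2"
    and T: "\<And>x. x \<in> S \<Longrightarrow> GDERIV F1 x :> T x" "\<And>x. x \<in> S \<Longrightarrow> GDERIV F2 x :> T x"
  shows "\<exists>c. \<forall>x\<in>S. F2 x = F1 x + c"
proof (cases "S = {}")
  case False
  define u where "u = legendre_on S F1"
  define v where "v = legendre_on S F2"
  have uv: "continuous_on UNIV u" "continuous_on UNIV v"
    unfolding u_def v_def by (intro convex_on_UNIV_imp_continuous convex_on_legendre F S False)+
  have eq: "u (T x) = x \<bullet> T x - F1 x" "v (T x) = x \<bullet> T x - F2 x" if "x \<in> S" for x
    unfolding u_def v_def
    by (rule legendre_on_subgradient[OF F(1) S that convex_on_GDERIV_le[OF F(1) T(1)[OF that]]],
        rule legendre_on_subgradient[OF F(2) S that convex_on_GDERIV_le[OF F(2) T(2)[OF that]]])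
  have sub: "u (T x) + x \<bullet> (z - T x) \<le> u z" "v (T x) + x \<bullet> (z - T x) \<le> v z" if "x \<in> S" for x z
    using eq[OF that] legendre_on_upper[OF F(1) S that, of z] legendre_on_upper[OF F(2) S that, of z]
    by (simp_all add: u_def v_def inner_diff_right)
  have common: "\<exists>p. (\<forall>z. u y + p \<bullet> (z - y) \<le> u z) \<and> (\<forall>z. v y + p \<bullet> (z - y) \<le> v z)" if y: "y \<in> C" for y
  proof -
    have "\<exists>Y. (\<forall>n. Y n \<in> T ` S) \<and> Y \<longlonglongrightarrow> y"
      using subsetD[OF C(3) y] by (simp only: closure_sequential)
    then obtain Y where Y: "\<forall>n. Y n \<in> T ` S" "Y \<longlonglongrightarrow> y"
      by (elim exE conjE)
    from Y(1) have "\<forall>n. \<exists>x. x \<in> S \<and> Y n = T x"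
      by blast
    then obtain X where X: "\<And>n. X n \<in> S" "\<And>n. Y n = T (X n)"
      by metis
    \<comment> \<open>The preimages \<open>X n\<close> are subgradients at \<open>Y n\<close> of
      both transforms, so the limit of one subsequence serves both at \<open>y\<close>.\<close>
    have "bounded (range X)"
      using S X(1) by (metis bounded_subset image_subsetI)
    then obtain p r where r: "strict_mono (r :: nat \<Rightarrow> nat)" "(X \<circ> r) \<longlonglongrightarrow> p"
      using bounded_imp_convergent_subsequence[of X] by blast
    have Yr: "(\<lambda>n. Y (r n)) \<longlonglongrightarrow> y"
      using LIMSEQ_subseq_LIMSEQ[OF Y(2) r(1)] by (simp add: o_def)
    have Xr: "(\<lambda>n. X (r n)) \<longlonglongrightarrow> p"
      using r(2) by (simp add: o_def)
    have lim: "h y + p \<bullet> (z - y) \<le> h z"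
      if h: "continuous_on UNIV h" and le: "\<And>n. h (Y n) + X n \<bullet> (z - Y n) \<le> h z"
      for h :: "'a \<Rightarrow> real" and z
    proof (rule tendsto_upperbound[OF _ always_eventually])
      have "(\<lambda>n. h (Y (r n))) \<longlonglongrightarrow> h y"
        using h Yr by (intro continuous_on_tendsto_compose[OF h]) auto
      then show "(\<lambda>n. h (Y (r n)) + X (r n) \<bullet> (z - Y (r n))) \<longlonglongrightarrow> h y + p \<bullet> (z - y)"
        by (intro tendsto_intros Xr Yr)
    qed (use le in auto)
    show ?thesis
      using lim[OF uv(1)] lim[OF uv(2)] sub X by metis
  qed
  obtain x0 where x0: "x0 \<in> S"
    using False by blast
  \<comment> \<open>Fenchel equality gives \<open>F2 x - F1 x = u (T x) - v (T x)\<close>, whose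
    value is fixed by the base point \<open>x0\<close>.\<close>
  have "F2 x = F1 x + (u (T x0) - v (T x0))" if "x \<in> S" for x
    using common_subgradients_imp_diff_const[OF C(1) _ _ common, of "T x0" "T x"] subsetD[OF C(2) imageI[OF x0]]
      subsetD[OF C(2) imageI[OF that]] eq[OF that]
    by simp
  then show ?thesis
    by blast
qed simp

subsection \<open>The objective functionals\<close>

lemma holder_on_imp_continuous_on:
  assumes f: "holder_on \<alpha> S f" and \<alpha>: "0 < \<alpha>"
  shows "continuous_on S f"
  unfolding continuous_on_def
proof
  fix x assume x: "x \<in> S"
  obtain C where C: "\<And>y. y \<in> S \<Longrightarrow> dist (f y) (f x) \<le> C * dist y x powr \<alpha>"
    using f x unfolding holder_on_def by blast
  have "((\<lambda>y. dist y x powr \<alpha>) \<longlongrightarrow> dist x x powr \<alpha>) (at x within S)"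
    using \<alpha> by (intro tendsto_powr' tendsto_intros) auto
  then have lim: "((\<lambda>y. C * dist y x powr \<alpha>) \<longlongrightarrow> 0) (at x within S)"
    using \<alpha> by (auto intro: tendsto_mult_right_zero)
  have "((\<lambda>y. dist (f y) (f x)) \<longlongrightarrow> 0) (at x within S)"
    by (rule tendsto_sandwich[OF _ _ tendsto_const lim]) (auto simp: eventually_at_filter C)
  then show "(f \<longlongrightarrow> f x) (at x within S)"
    by (simp add: tendsto_dist_iff[of f])
qed

section \<open>First and second derivatives of functions in \<open>C2_on\<close>\<close>

lemma C2_on_GDERIV_gradient:
  "C2_on S \<psi> \<Longrightarrow> x \<in> S \<Longrightarrow> GDERIV \<psi> x :> gradient \<psi> x"
  by (simp add: C2_on_def GDERIV_gradient)

lemma C2_on_gradient_has_derivative: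
  "C2_on S \<psi> \<Longrightarrow> x \<in> S \<Longrightarrow> (gradient \<psi> has_derivative (\<lambda>h. hessian \<psi> x *v h)) (at x)"
  by (simp add: C2_on_def hessian_def flip: jacobian_works)

lemma C2_on_continuous_gradient: "C2_on S \<psi> \<Longrightarrow> continuous_on S (gradient \<psi>)"
  using C2_on_gradient_has_derivative
  by (meson continuous_at_imp_continuous_on has_derivative_continuous)

lemma C2_on_continuous_det_hessian: "C2_on S \<psi> \<Longrightarrow> continuous_on S (\<lambda>x. det (hessian \<psi> x))"
  unfolding C2_on_def det_def by (intro continuous_intros) auto

text \<open>Prepares the passage from the \<open>lborel\<close> integrals of the mass condition to
  gauge integrals. The integrand extended by zero is Borel measurable, so completing the measure
  does not affect integrability.\<close>

lemma set_integrable_lborel_iff_lebesgue: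
  fixes h :: "'a::euclidean_space \<Rightarrow> real"
  assumes "open S" "continuous_on S h"
  shows "set_integrable lborel S h \<longleftrightarrow> set_integrable lebesgue S h"
proof -
  have "(\<lambda>x. indicator S x *\<^sub>R h x) \<in> borel_measurable lborel"
    using borel_measurable_continuous_on_indicator[of S h] assms by simp
  then show ?thesis
    unfolding set_integrable_def by (simp add: integrable_completion)
qed

text \<open>Separating determinant and quotient by levels \<open>m < m'\<close> bounds the integrand
  below independently of \<open>x\<close>. If the determinant is not positive, \<open>elog\<close>
  is minus infinity and the bound holds trivially.\<close>

lemma G1_lower_bound:
  assumes pos: "0 < f x" "0 < g (gradient \<psi> x)"
    and m: "0 < m" "det (hessian \<psi> x) < m" "m' < f x / g (gradient \<psi> x)" "m < m'"
  shows "ennreal (ln m' - ln m) \<le> G1 f g \<psi> x"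
proof -
  let ?d = "det (hessian \<psi> x)" and ?q = "f x / g (gradient \<psi> x)"
  have "ereal (ln m' - ln m) \<le> - elog ?d - ereal (ln (g (gradient \<psi> x))) + ereal (ln (f x))"
  proof (cases "0 < ?d")
    case True
    then have "ln ?d < ln m" "ln m' < ln ?q"
      using m pos by auto
    then show ?thesis
      using True pos by (simp add: elog_def ln_div)
  next
    case False
    then show ?thesis
      by (simp add: elog_def)
  qed
  then have "e2ennreal (ereal (ln m' - ln m)) \<le> G1 f g \<psi> x"
    unfolding G1_def by (intro e2ennreal_mono max.coboundedI2)
  then show ?thesis
    by simp
qed

text \<open>Here \<open>root\<close> is strictly increasing on the whole real line, which covers
  determinants of any sign.\<close>

lemma G2_lower_bound:
  fixes \<psi> :: "real ^ 'n \<Rightarrow> real"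
  assumes "det (hessian \<psi> x) < m" "m' < f x / g (gradient \<psi> x)"
  shows "ennreal (root CARD('n) m' - root CARD('n) m) \<le> G2 f g \<psi> x"
proof -
  have "root CARD('n) (det (hessian \<psi> x)) < root CARD('n) m"
    "root CARD('n) m' < root CARD('n) (f x / g (gradient \<psi> x))"
    using assms by simp_all
  then show ?thesis
    unfolding G2_def by (intro ennreal_leI max.coboundedI2) linarith
qed

text \<open>By continuity a violation at one point persists with a uniform margin on an open
  neighbourhood, where the integrand then exceeds a positive constant.\<close>

lemma objective_0_imp_det_ge:
  fixes \<psi> :: "real ^ 'n \<Rightarrow> real"
  assumes \<Omega>: "open \<Omega>" and \<psi>: "C2_on \<Omega> \<psi>" "gradient \<psi> ` \<Omega> \<subseteq> \<Lambda>"
    and f: "continuous_on \<Omega> f" "\<And>x. x \<in> \<Omega> \<Longrightarrow> 0 < f x"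
    and g: "continuous_on \<Lambda> g" "\<And>y. y \<in> \<Lambda> \<Longrightarrow> 0 < g y"
    and G: "G \<in> {G1 f g, G2 f g}" and zero: "objective \<Omega> G \<psi> = 0" and x: "x \<in> \<Omega>"
  shows "f x / g (gradient \<psi> x) \<le> det (hessian \<psi> x)"
proof (rule ccontr)
  let ?d = "\<lambda>x. det (hessian \<psi> x)" and ?q = "\<lambda>x. f x / g (gradient \<psi> x)"
  have gpos: "0 < g (gradient \<psi> z)" if "z \<in> \<Omega>" for z
    using g(2) \<psi>(2) that by blast
  assume "\<not> ?q x \<le> ?d x"
  moreover have "0 < ?q x"
    using f(2)[OF x] gpos[OF x] by simp
  ultimately have "max 0 (?d x) < ?q x"
    by simp
  \<comment> \<open>Lying above \<open>max 0\<close>, the level \<open>m\<close> is positive, as the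
    logarithmic bound for \<open>G1\<close> requires.\<close>
  then obtain m where m: "max 0 (?d x) < m" "m < ?q x"
    using dense by blast
  obtain m' where m': "m < m'" "m' < ?q x"
    using dense[OF m(2)] by blast
  define U where "U = {z \<in> \<Omega>. ?d z < m \<and> m' < ?q z}"
  have contq: "continuous_on \<Omega> ?q"
    using gpos C2_on_continuous_gradient[OF \<psi>(1)]
    by (intro continuous_intros f(1) continuous_on_compose2[OF g(1) _ \<psi>(2)]) force+
  have "open (\<Omega> \<inter> ?d -` {..<m} \<inter> (\<Omega> \<inter> ?q -` {m'<..}))"
    by (intro open_Int continuous_open_preimage contq C2_on_continuous_det_hessian \<psi>(1) \<Omega>) auto
  moreover have "U = \<Omega> \<inter> ?d -` {..<m} \<inter> (\<Omega> \<inter> ?q -` {m'<..})"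
    by (auto simp: U_def)
  ultimately have U: "open U"
    by simp
  have "\<exists>\<epsilon>>0. \<forall>z\<in>U. ennreal \<epsilon> \<le> G \<psi> z"
  proof (cases "G = G1 f g")
    case True
    have "ennreal (ln m' - ln m) \<le> G \<psi> z" if "z \<in> U" for z
      unfolding True using that f(2) gpos m m' by (intro G1_lower_bound) (auto simp: U_def)
    moreover have "0 < ln m' - ln m"
      using m m' by simp
    ultimately show ?thesis
      by blast
  next
    case False
    then have "G = G2 f g"
      using G by blast
    then have "ennreal (root CARD('n) m' - root CARD('n) m) \<le> G \<psi> z" if "z \<in> U" for z
      using that by (simp add: G2_lower_bound U_def)
    moreover have "0 < root CARD('n) m' - root CARD('n) m"
      using m' by simp
    ultimately show ?thesis
      by blast
  qed
  then obtain \<epsilon> where \<epsilon>: "\<epsilon> > 0" "\<And>z. z \<in> U \<Longrightarrow> ennreal \<epsilon> \<le> G \<psi> z"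
    by blast
  \<comment> \<open>Markov-type bound: a zero integral makes \<open>U\<close> null, which is
    impossible for a nonempty open set.\<close>
  have "ennreal \<epsilon> * emeasure lborel U = (\<integral>\<^sup>+ z. ennreal \<epsilon> * indicator U z \<partial>lborel)"
    using U by (simp add: nn_integral_cmult_indicator)
  also have "\<dots> \<le> objective \<Omega> G \<psi>"
    unfolding objective_def using \<epsilon>(2)
    by (intro nn_integral_mono) (auto simp: U_def split: split_indicator)
  finally have "emeasure lborel U = 0"
    using zero \<epsilon>(1) by simp
  then have "U \<in> null_sets lborel"
    using U by (simp add: null_sets_def)
  then have "negligible U"
    by (simp add: negligible_iff_null_sets null_sets_completionI)
  moreover have "x \<in> U"
    using x m m' by (simp add: U_def)
  ultimately show False
    using U by (metis empty_iff open_not_negligible)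
qed

text \<open>The Monge-Ampere equation makes the second argument of \<open>max\<close> zero in both
  integrands.\<close>

lemma objective_eq_0:
  fixes \<phi> :: "real ^ 'n \<Rightarrow> real"
  assumes pos: "\<And>x. x \<in> \<Omega> \<Longrightarrow> 0 < f x" "\<And>x. x \<in> \<Omega> \<Longrightarrow> 0 < g (gradient \<phi> x)"
    and det: "\<And>x. x \<in> \<Omega> \<Longrightarrow> det (hessian \<phi> x) = f x / g (gradient \<phi> x)"
    and G: "G \<in> {G1 f g, G2 f g}"
  shows "objective \<Omega> G \<phi> = 0"
proof -
  have "G \<phi> x = 0" if x: "x \<in> \<Omega>" for x
  proof -
    have "G1 f g \<phi> x = 0"
      using pos[OF x] det[OF x] by (simp add: G1_def elog_def ln_div flip: zero_ennreal.abs_eq)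
    moreover have "G2 f g \<phi> x = 0"
      using det[OF x] by (simp add: G2_def)
    ultimately show ?thesis
      using G by blast
  qed
  then have "objective \<Omega> G \<phi> = (\<integral>\<^sup>+ x. 0 \<partial>(lborel :: (real ^ 'n) measure))"
    unfolding objective_def by (intro nn_integral_cong) (auto split: split_indicator)
  then show ?thesis
    by simp
qed

text \<open>Collects, for any admissible zero of the objective, the data needed to compare two
  potentials. A global convex \<open>\<Psi>\<close> stands in for \<open>\<psi>\<close>, which is
  convex only as a restriction; their gradients agree on the open set
  \<open>\<Omega>\<close>.\<close>

lemma zero_objective_imp_transport:
  fixes \<Omega> \<Lambda> :: "(real ^ 'n) set" and f g \<psi> :: "real ^ 'n \<Rightarrow> real"
  assumes \<Omega>: "open \<Omega>" "bounded \<Omega>" and \<Lambda>: "open \<Lambda>" "bounded \<Lambda>"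
    and f: "continuous_on \<Omega> f" "\<And>x. x \<in> \<Omega> \<Longrightarrow> 0 < f x" "\<And>x. x \<in> \<Omega> \<Longrightarrow> f x \<le> Cf"
    and g: "continuous_on \<Lambda> g" "0 < cg" "\<And>y. y \<in> \<Lambda> \<Longrightarrow> cg \<le> g y" "\<And>y. y \<in> \<Lambda> \<Longrightarrow> g y \<le> Cg"
    and mass: "integral \<Omega> f = integral \<Lambda> g"
    and G: "G \<in> {G1 f g, G2 f g}"
    and \<psi>: "\<psi> \<in> admissible \<Omega> \<Lambda>" "objective \<Omega> G \<psi> = 0"
  obtains \<Psi> where "convex_on UNIV \<Psi>" "\<And>x. x \<in> \<Omega> \<Longrightarrow> \<Psi> x = \<psi> x"
    "\<And>x. x \<in> \<Omega> \<Longrightarrow> GDERIV \<Psi> x :> gradient \<psi> x"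
    "\<And>h. continuous_on UNIV h \<Longrightarrow> integral \<Omega> (\<lambda>x. h (gradient \<psi> x) * f x) = integral \<Lambda> (\<lambda>y. h y * g y)"
    "\<Lambda> \<subseteq> closure (gradient \<psi> ` \<Omega>)"
proof -
  have C2: "C2_on \<Omega> \<psi>" and grad: "gradient \<psi> ` \<Omega> \<subseteq> \<Lambda>"
    using \<psi>(1) by (auto simp: admissible_def)
  obtain \<Psi> where \<Psi>: "convex_on UNIV \<Psi>" "\<And>x. x \<in> \<Omega> \<Longrightarrow> \<Psi> x = \<psi> x"
    using \<psi>(1) by (auto simp: admissible_def convex_restriction_def)
  have gpos: "0 < g y" if "y \<in> \<Lambda>" for y
    using g(2) g(3)[OF that] by simp
  have D: "GDERIV \<Psi> x :> gradient \<psi> x" if "x \<in> \<Omega>" for x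
    using GDERIV_local_eq[OF C2_on_GDERIV_gradient[OF C2 that] \<Omega>(1) that] \<Psi>(2) by metis
  have ge: "f x / g (gradient \<psi> x) \<le> det (hessian \<psi> x)" if "x \<in> \<Omega>" for x
    by (rule objective_0_imp_det_ge[OF \<Omega>(1) C2 grad f(1,2) g(1) gpos G \<psi>(2) that])
  have "0 < det (hessian \<psi> x)" if "x \<in> \<Omega>" for x
    using ge[OF that] f(2)[OF that] gpos[of "gradient \<psi> x"] grad that
    by (smt (verit) divide_pos_pos image_subset_iff)
  then have inj: "inj_on (gradient \<psi>) \<Omega>"
    by (intro inj_on_gradient_of_convex[OF \<Omega>(1) \<Psi>(1) D C2_on_gradient_has_derivative[OF C2]]) force+
  note push = pushforward_of_det_ge[OF \<Omega> \<Lambda> f g mass grad inj C2_on_gradient_has_derivative[OF C2]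
      C2_on_continuous_det_hessian[OF C2] ge]
  have "integral \<Omega> (\<lambda>x. h (gradient \<psi> x) * f x) = integral \<Lambda> (\<lambda>y. h y * g y)"
    if h: "continuous_on UNIV h" for h
  proof -
    obtain B where "\<forall>y\<in>\<Lambda>. \<bar>h y\<bar> \<le> B"
      using continuous_on_UNIV_imp_bounded[OF h \<Lambda>(2)] by blast
    then show ?thesis
      using push(1)[of h B] continuous_on_subset[OF h subset_UNIV] by blast
  qed
  then show thesis
    using that[OF \<Psi> D _ push(2)] by blast
qed

theorem proposition1:
  fixes \<Omega> \<Lambda> :: "(real ^ 'n) set"
    and f g \<phi> :: "real ^ 'n \<Rightarrow> real"
    and \<alpha> :: real
  assumes "open \<Omega>" and "bounded \<Omega>"
    and "open \<Lambda>" and "bounded \<Lambda>" and "convex \<Lambda>"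
    and "0 < \<alpha>" and "\<alpha> < 1"
    and "holder_on \<alpha> (closure \<Omega>) f" and "holder_on \<alpha> (closure \<Lambda>) g"
    and "\<exists>c C. 0 < c \<and> (\<forall>x\<in>closure \<Omega>. c \<le> f x \<and> f x \<le> C)"
    and "\<exists>c C. 0 < c \<and> (\<forall>y\<in>closure \<Lambda>. c \<le> g y \<and> g y \<le> C)"
    and "(LINT x:\<Omega>|lborel. f x) = (LINT y:\<Lambda>|lborel. g y)"
    and "brenier_potential \<Omega> f \<Lambda> g \<phi>"
    and "C2_holder_on \<alpha> \<Omega> \<phi>"
    and "\<forall>x\<in>\<Omega>. det (hessian \<phi> x) = f x / g (gradient \<phi> x)"
    and "(\<Union>x\<in>\<Omega>. subdifferential \<phi> x) \<subseteq> closure \<Lambda>"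
  shows "\<forall>G \<in> {G1 f g, G2 f g}.
      is_arg_min (objective \<Omega> G) (\<lambda>\<psi>. \<psi> \<in> admissible \<Omega> \<Lambda>) \<phi> \<and>
      (\<forall>\<psi>. is_arg_min (objective \<Omega> G) (\<lambda>\<eta>. \<eta> \<in> admissible \<Omega> \<Lambda>) \<psi> \<longrightarrow>
        (\<exists>c. \<forall>x\<in>\<Omega>. \<psi> x = \<phi> x + c))"
proof
  fix G assume G: "G \<in> {G1 f g, G2 f g}"
  note \<Omega> = \<open>open \<Omega>\<close> \<open>bounded \<Omega>\<close> and \<Lambda> = \<open>open \<Lambda>\<close> \<open>bounded \<Lambda>\<close>
  have cont_closure: "continuous_on (closure \<Omega>) f" "continuous_on (closure \<Lambda>) g"
    using assms(6,8,9) holder_on_imp_continuous_on by blast+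
  then have cont: "continuous_on \<Omega> f" "continuous_on \<Lambda> g"
    by (meson closure_subset continuous_on_subset)+
  obtain cf Cf where cf: "0 < cf" "\<And>x. x \<in> closure \<Omega> \<Longrightarrow> cf \<le> f x \<and> f x \<le> Cf"
    using assms(10) by blast
  obtain cg Cg where cg: "0 < cg" "\<And>y. y \<in> closure \<Lambda> \<Longrightarrow> cg \<le> g y \<and> g y \<le> Cg"
    using assms(11) by blast
  have f: "0 < f x" "f x \<le> Cf" if "x \<in> \<Omega>" for x
    using cf subsetD[OF closure_subset that] by force+
  have g: "cg \<le> g y" "g y \<le> Cg" if "y \<in> \<Lambda>" for y
    using cg(2) subsetD[OF closure_subset that] by force+
  have "f absolutely_integrable_on \<Omega>" "g absolutely_integrable_on \<Lambda>"
    using f g cg(1)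
    by (intro continuous_bounded_imp_absolutely_integrable[OF \<Omega> cont(1), of Cf]
        continuous_bounded_imp_absolutely_integrable[OF \<Lambda> cont(2), of Cg]; fastforce)+
  \<comment> \<open>The mass condition is rewritten with gauge integrals, the form used by the
    transport lemmas.\<close>
  then have mass: "integral \<Omega> f = integral \<Lambda> g"
    using assms(12) \<Omega>(1) \<Lambda>(1) cont
    by (simp add: set_borel_integral_eq_integral(2) set_integrable_lborel_iff_lebesgue)
  have \<phi>: "convex_on UNIV \<phi>" "C2_on \<Omega> \<phi>"
    using assms(13,14) by (auto simp: brenier_potential_def C2_holder_on_def)
  have cl: "gradient \<phi> x \<in> closure \<Lambda>" if "x \<in> \<Omega>" for x
    using convex_on_GDERIV_le[OF \<phi>(1) C2_on_GDERIV_gradient[OF \<phi>(2) that]] assms(16) that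
    by (auto simp: subdifferential_def)
  \<comment> \<open>The bounds on \<open>closure \<Lambda>\<close> are used here, since the gradient
    is so far only known to lie in the closure.\<close>
  have gpos: "0 < g (gradient \<phi> x)" if "x \<in> \<Omega>" for x
    using cg cl[OF that] by force
  \<comment> \<open>Being open, the image lies in the interior of \<open>closure \<Lambda>\<close>,
    which is \<open>\<Lambda>\<close> itself because \<open>\<Lambda>\<close> is open and
    convex.\<close>
  have "open (gradient \<phi> ` \<Omega>)"
    using f gpos assms(15)
    by (intro open_image_nonsingular[OF \<Omega>(1) C2_on_gradient_has_derivative[OF \<phi>(2)]]) force+
  then have "gradient \<phi> ` \<Omega> \<subseteq> interior (closure \<Lambda>)"
    using cl by (intro interior_maximal) auto
  then have grad: "gradient \<phi> ` \<Omega> \<subseteq> \<Lambda>"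
    using convex_interior_closure[OF \<open>convex \<Lambda>\<close>] \<Lambda>(1) by (simp add: interior_open)
  have adm: "\<phi> \<in> admissible \<Omega> \<Lambda>"
    using \<phi> grad by (auto simp: admissible_def convex_restriction_def)
  have zero: "objective \<Omega> G \<phi> = 0"
    using f gpos assms(15) G by (intro objective_eq_0) auto
  have "\<exists>c. \<forall>x\<in>\<Omega>. \<psi> x = \<phi> x + c"
    if min: "is_arg_min (objective \<Omega> G) (\<lambda>\<eta>. \<eta> \<in> admissible \<Omega> \<Lambda>) \<psi>" for \<psi>
  proof -
    \<comment> \<open>Since \<open>\<phi>\<close> attains 0, the least value in
      \<open>ennreal\<close>, every minimizer has value 0.\<close>
    have \<psi>: "\<psi> \<in> admissible \<Omega> \<Lambda>" "objective \<Omega> G \<psi> = 0"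
      using min adm zero by (auto simp: is_arg_min_def zero_less_iff_neq_zero)
    note transport = zero_objective_imp_transport[OF \<Omega> \<Lambda> cont(1) f cont(2) cg(1) g mass G]
    \<comment> \<open>As \<open>\<phi>\<close> is itself an admissible zero, its push-forward and
      density properties come from the same lemma as those of \<open>\<psi>\<close>.\<close>
    obtain F1 where F1: "convex_on UNIV F1" "\<And>x. x \<in> \<Omega> \<Longrightarrow> F1 x = \<phi> x"
      "\<And>x. x \<in> \<Omega> \<Longrightarrow> GDERIV F1 x :> gradient \<phi> x"
      "\<And>h. continuous_on UNIV h \<Longrightarrow>
        integral \<Omega> (\<lambda>x. h (gradient \<phi> x) * f x) = integral \<Lambda> (\<lambda>y. h y * g y)"
      "\<Lambda> \<subseteq> closure (gradient \<phi> ` \<Omega>)"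
      by (rule transport[OF _ _ _ _ adm zero that])
    obtain F2 where F2: "convex_on UNIV F2" "\<And>x. x \<in> \<Omega> \<Longrightarrow> F2 x = \<psi> x"
      "\<And>x. x \<in> \<Omega> \<Longrightarrow> GDERIV F2 x :> gradient \<psi> x"
      "\<And>h. continuous_on UNIV h \<Longrightarrow>
        integral \<Omega> (\<lambda>x. h (gradient \<psi> x) * f x) = integral \<Lambda> (\<lambda>y. h y * g y)"
      "\<Lambda> \<subseteq> closure (gradient \<psi> ` \<Omega>)"
      by (rule transport[OF _ _ _ _ \<psi> that])
    have C2: "C2_on \<Omega> \<psi>" and grad': "gradient \<psi> ` \<Omega> \<subseteq> \<Lambda>"
      using \<psi>(1) by (auto simp: admissible_def)
    have "gradient \<phi> x = gradient \<psi> x" if "x \<in> \<Omega>" for x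
      by (rule gradient_maps_eq[OF \<Omega> cont(1) f F1(1) F2(1) F1(3) F2(3)
            C2_on_continuous_gradient[OF \<phi>(2)] C2_on_continuous_gradient[OF C2]
            bounded_subset[OF \<Lambda>(2) grad] bounded_subset[OF \<Lambda>(2) grad'] _ that])
         (simp_all add: F1(4) F2(4))
    then have "\<exists>c. \<forall>x\<in>\<Omega>. F2 x = F1 x + c"
      using F2(3)
      by (intro potentials_diff_const[OF \<Omega>(2) \<open>convex \<Lambda>\<close> grad F1(5) F1(1) F2(1) F1(3)]) simp_all
    then show ?thesis
      using F1(2) F2(2) by simp
  qed
  moreover have "is_arg_min (objective \<Omega> G) (\<lambda>\<psi>. \<psi> \<in> admissible \<Omega> \<Lambda>) \<phi>"
    using adm zero by (simp add: is_arg_min_def)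
  ultimately show "is_arg_min (objective \<Omega> G) (\<lambda>\<psi>. \<psi> \<in> admissible \<Omega> \<Lambda>) \<phi> \<and>
      (\<forall>\<psi>. is_arg_min (objective \<Omega> G) (\<lambda>\<eta>. \<eta> \<in> admissible \<Omega> \<Lambda>) \<psi> \<longrightarrow>
        (\<exists>c. \<forall>x\<in>\<Omega>. \<psi> x = \<phi> x + c))"
    by blast
qed

end
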